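(* Let $\mathcal H$ be a complex Hilbert space with open unit ball $B$, let $a,b\in B$ with $a\neq 0$, and let $U,V$ be unitary operators on $\mathcal H$. Then $M_{\phi_{a,U}}\perp_B M_{\phi_{b,V}}$ if and only if $\phi_{a,U}(-a/\|a\|)$ and $\phi_{b,V}(-a/\|a\|)$ are antipodal points of the unit sphere $\partial B$, i.e. $\phi_{a,U}(-a/\|a\|)=-\phi_{b,V}(-a/\|a\|)$.
   Context: The inner product of $\mathcal H$ is linear in the first variable. For $a\in B$ and a unitary operator $U$ on $\mathcal H$, put $\alpha(a)=\sqrt{1-\|a\|^2}$, let $P_a$ be the orthogonal projection onto $\mathbb Ca$ and $Q_a=I-P_a$ (so $P_0=0$, $Q_0=I$). The automorphism $\phi_{a,U}\in\operatorname{Aut}(B)$ is $\phi_{a,U}(z)=U\frac{(P_a+\alpha(a)Q_a)z-a}{1-\langle z,a\rangle}$; the same formula defines its continuous extension to the closed unit ball, which maps the unit sphere $\partial B$ homeomorphically onto itself. The associated bounded operator $M_{\phi_{a,U}}$ on the Hilbert space direct sum $\mathcal H\oplus\mathbb C$ is $$M_{\phi_{a,U}}(x,\lambda)=\bigl(U(P_a+\alpha(a)Q_a)x-\lambda Ua,\ -\langle x,a\rangle+\lambda\bigr).$$ For $S,T\in\mathcal B(\mathcal H\oplus\mathbb C)$ (bounded operators, operator norm), Birkhoff--James orthogonality $S\perp_B T$ means $\|S+\lambda T\|\ge\|S\|$ for all $\lambda\in\mathbb C$. *)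

theory Defs
  imports "HOL-Analysis.Analysis"
begin

section \<open>Complex Hilbert spaces\<close>

text \<open>The inner product is linear in the first variable and the norm is the one it induces.
  Real and complex scalar multiplication agree on real scalars, so that the topology, \<^const>\<open>onorm\<close>
  and the product norm of the real theory are the ones of the complex space.\<close>

class complex_inner = real_normed_vector +
  fixes scaleC :: "complex \<Rightarrow> 'a \<Rightarrow> 'a" (infixr "*\<^sub>C" 75)
    and cinner :: "'a \<Rightarrow> 'a \<Rightarrow> complex"
  assumes scaleC_add_right: "c *\<^sub>C (x + y) = c *\<^sub>C x + c *\<^sub>C y"
    and scaleC_add_left: "(c + d) *\<^sub>C x = c *\<^sub>C x + d *\<^sub>C x"
    and scaleC_scaleC: "c *\<^sub>C d *\<^sub>C x = (c * d) *\<^sub>C x"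
    and scaleC_of_real: "complex_of_real r *\<^sub>C x = r *\<^sub>R x"
    and cinner_commute: "cinner x y = cnj (cinner y x)"
    and cinner_add_left: "cinner (x + y) z = cinner x z + cinner y z"
    and cinner_scaleC_left: "cinner (c *\<^sub>C x) y = c * cinner x y"
    and cinner_self: "cinner x x = complex_of_real ((norm x)\<^sup>2)"

class complex_hilbert_space = complex_inner + complete_space

lemma scaleC_one [simp]: "1 *\<^sub>C x = (x :: 'a :: complex_inner)"
  using scaleC_of_real[of 1 x] by simp

interpretation complex_vector: vector_space "scaleC :: complex \<Rightarrow> 'a \<Rightarrow> 'a :: complex_inner"
  by unfold_locales (simp_all add: scaleC_add_right scaleC_add_left scaleC_scaleC)

abbreviation clinear :: "('a :: complex_inner \<Rightarrow> 'b :: complex_inner) \<Rightarrow> bool"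
  where "clinear \<equiv> Vector_Spaces.linear scaleC scaleC"

lemma cinner_add_right: "cinner x (y + z) = cinner x y + cinner x (z :: 'a :: complex_inner)"
  by (metis cinner_add_left cinner_commute complex_cnj_add)

lemma cinner_scaleC_right: "cinner x (c *\<^sub>C y) = cnj c * cinner x (y :: 'a :: complex_inner)"
  by (metis cinner_commute cinner_scaleC_left complex_cnj_mult)

lemma cinner_zero_left [simp]: "cinner 0 (y :: 'a :: complex_inner) = 0"
  using cinner_add_left[of 0 0 y] by simp

lemma cinner_zero_right [simp]: "cinner (y :: 'a :: complex_inner) 0 = 0"
  using cinner_add_right[of y 0 0] by simp

lemma cinner_diff_left: "cinner (x - y) z = cinner x z - cinner y (z :: 'a :: complex_inner)"
  using cinner_add_left[of "x - y" y z] by simp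

lemma norm_scaleC: "norm (c *\<^sub>C x) = norm c * norm (x :: 'a :: complex_inner)"
proof -
  have "complex_of_real ((norm (c *\<^sub>C x))\<^sup>2) = complex_of_real ((norm c * norm x)\<^sup>2)"
    unfolding cinner_self[symmetric] cinner_scaleC_left cinner_scaleC_right
    by (simp add: cinner_self power_mult_distrib complex_norm_square mult.assoc[symmetric]
        del: of_real_power)
  then have "(norm (c *\<^sub>C x))\<^sup>2 = (norm c * norm x)\<^sup>2"
    using of_real_eq_iff by blast
  then show ?thesis by (simp add: power2_eq_iff_nonneg)
qed

instantiation complex :: complex_hilbert_space
begin
definition scaleC_complex :: "complex \<Rightarrow> complex \<Rightarrow> complex"
  where "scaleC_complex = (*)"
definition cinner_complex :: "complex \<Rightarrow> complex \<Rightarrow> complex"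
  where "cinner_complex x y = x * cnj y"
instance
  by standard
    (simp_all add: scaleC_complex_def cinner_complex_def algebra_simps scaleR_conv_of_real
      complex_norm_square del: of_real_power)
end

text \<open>The Hilbert space direct sum; the library norm on pairs is already the Hilbertian one.\<close>

instantiation prod :: (complex_inner, complex_inner) complex_inner
begin
definition scaleC_prod :: "complex \<Rightarrow> 'a \<times> 'b \<Rightarrow> 'a \<times> 'b"
  where "scaleC_prod c p = (c *\<^sub>C fst p, c *\<^sub>C snd p)"
definition cinner_prod :: "'a \<times> 'b \<Rightarrow> 'a \<times> 'b \<Rightarrow> complex"
  where "cinner_prod p q = cinner (fst p) (fst q) + cinner (snd p) (snd q)"
instance
proof
  fix x y :: "'a \<times> 'b"
  show "cinner x y = cnj (cinner y x)"
    unfolding cinner_prod_def complex_cnj_add by (metis cinner_commute)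
qed (simp_all add: scaleC_prod_def cinner_prod_def scaleC_add_right scaleC_add_left
    scaleC_scaleC scaleC_of_real cinner_add_left cinner_scaleC_left cinner_self norm_prod_def
    scaleR_prod_def algebra_simps)
end

instance prod :: (complex_hilbert_space, complex_hilbert_space) complex_hilbert_space ..

section \<open>Operators and automorphisms of the ball\<close>

definition unitary :: "('a :: complex_inner \<Rightarrow> 'a) \<Rightarrow> bool"
  where "unitary U \<longleftrightarrow> clinear U \<and> surj U \<and> (\<forall>x y. cinner (U x) (U y) = cinner x y)"

definition orth_proj :: "'a :: complex_inner set \<Rightarrow> 'a \<Rightarrow> 'a"
  where "orth_proj M x = (THE y. y \<in> M \<and> (\<forall>m\<in>M. cinner (x - y) m = 0))"

definition proj :: "'a :: complex_inner \<Rightarrow> 'a \<Rightarrow> 'a"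
  where "proj a = orth_proj (range (\<lambda>c. c *\<^sub>C a))"

definition coproj :: "'a :: complex_inner \<Rightarrow> 'a \<Rightarrow> 'a"
  where "coproj a x = x - proj a x"

definition alpha :: "'a :: complex_inner \<Rightarrow> real"
  where "alpha a = sqrt (1 - (norm a)\<^sup>2)"

text \<open>Meaningful for \<open>norm a < 1\<close> and \<open>norm z \<le> 1\<close>, where the denominator does not vanish; the
  formula covers both the automorphism of the open ball and its extension to the closed ball.\<close>

definition phi :: "'a :: complex_inner \<Rightarrow> ('a \<Rightarrow> 'a) \<Rightarrow> 'a \<Rightarrow> 'a"
  where "phi a U z = U ((1 / (1 - cinner z a)) *\<^sub>C (proj a z + alpha a *\<^sub>R coproj a z - a))"

definition M_phi :: "'a :: complex_inner \<Rightarrow> ('a \<Rightarrow> 'a) \<Rightarrow> 'a \<times> complex \<Rightarrow> 'a \<times> complex"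
  where "M_phi a U = (\<lambda>(x, l). (U (proj a x + alpha a *\<^sub>R coproj a x) - l *\<^sub>C U a, - cinner x a + l))"

text \<open>Only used for bounded operators, where \<^const>\<open>onorm\<close> is the operator norm.\<close>

definition bj_orthogonal :: "('a :: complex_inner \<Rightarrow> 'b :: complex_inner) \<Rightarrow> ('a \<Rightarrow> 'b) \<Rightarrow> bool"
    (infix "\<bottom>\<^sub>B" 50)
  where "S \<bottom>\<^sub>B T \<longleftrightarrow> (\<forall>c. onorm (\<lambda>x. S x + c *\<^sub>C T x) \<ge> onorm S)"

section \<open>Explicit projection and boundedness of the associated operator\<close>

lemma proj_eq: "proj a x = (cinner x a / cinner a a) *\<^sub>C (a :: 'a :: complex_inner)"
proof (cases "a = 0")
  case True
  then show ?thesis by (simp add: proj_def orth_proj_def image_def)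
next
  case False
  then have a: "cinner a a \<noteq> 0" by (simp add: cinner_self)
  show ?thesis unfolding proj_def orth_proj_def
  proof (rule the_equality)
    show "(cinner x a / cinner a a) *\<^sub>C a \<in> range (\<lambda>c. c *\<^sub>C a) \<and>
      (\<forall>m\<in>range (\<lambda>c. c *\<^sub>C a). cinner (x - (cinner x a / cinner a a) *\<^sub>C a) m = 0)"
      using a by (auto simp: cinner_diff_left cinner_scaleC_left cinner_scaleC_right)
  next
    fix y
    assume y: "y \<in> range (\<lambda>c. c *\<^sub>C a) \<and> (\<forall>m\<in>range (\<lambda>c. c *\<^sub>C a). cinner (x - y) m = 0)"
    then obtain c where c: "y = c *\<^sub>C a" by auto
    have "a \<in> range (\<lambda>c. c *\<^sub>C a)" by (metis rangeI scaleC_one)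
    with y have "cinner (x - y) a = 0" by blast
    then have "c = cinner x a / cinner a a"
      using a by (simp add: c cinner_diff_left cinner_scaleC_left field_simps)
    then show "y = (cinner x a / cinner a a) *\<^sub>C a" by (simp add: c)
  qed
qed

lemma Cauchy_Schwarz: "norm (cinner x y) \<le> norm x * norm (y :: 'a :: complex_inner)"
proof (cases "y = 0")
  case False
  define c where "c = cinner x y / cinner y y"
  have y: "norm y \<noteq> 0" using False by simp
  have yy: "cinner y y \<noteq> 0" using False by (simp add: cinner_self)
  have o: "cinner (x - c *\<^sub>C y) y = 0"
    using yy by (simp add: c_def cinner_diff_left cinner_scaleC_left)
  then have o': "cinner y (x - c *\<^sub>C y) = 0" by (subst cinner_commute) simp
  have "cinner x x = cinner ((x - c *\<^sub>C y) + c *\<^sub>C y) ((x - c *\<^sub>C y) + c *\<^sub>C y)" by simp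
  also have "\<dots> = cinner (x - c *\<^sub>C y) (x - c *\<^sub>C y) + cinner (c *\<^sub>C y) (c *\<^sub>C y)"
    unfolding cinner_add_left cinner_add_right cinner_scaleC_left cinner_scaleC_right o o' by simp
  finally have "complex_of_real ((norm x)\<^sup>2) =
      complex_of_real ((norm (x - c *\<^sub>C y))\<^sup>2 + (norm (c *\<^sub>C y))\<^sup>2)"
    by (simp only: cinner_self of_real_add)
  then have "(norm x)\<^sup>2 = (norm (x - c *\<^sub>C y))\<^sup>2 + (norm (c *\<^sub>C y))\<^sup>2"
    using of_real_eq_iff by blast
  then have "(norm (c *\<^sub>C y))\<^sup>2 \<le> (norm x)\<^sup>2" by simp
  then have "norm c * norm y \<le> norm x"
    by (metis norm_ge_zero norm_scaleC power2_le_imp_le)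
  moreover have "norm c * norm y = norm (cinner x y) / norm y"
    using y by (simp add: c_def norm_divide cinner_self power2_eq_square norm_mult)
  ultimately show ?thesis using y by (simp add: field_simps)
qed simp

lemma unitary_norm: "unitary U \<Longrightarrow> norm (U x) = norm x"
  unfolding unitary_def by (metis cinner_self norm_ge_zero of_real_eq_iff power2_eq_iff_nonneg)

lemma M_phi_clinear:
  assumes "unitary U"
  shows "clinear (M_phi a U)"
proof -
  interpret U: Vector_Spaces.linear scaleC scaleC U
    using assms by (simp add: unitary_def)
  have R: "r *\<^sub>R x = complex_of_real r *\<^sub>C x" for r and x :: 'a
    by (simp add: scaleC_of_real)
  show ?thesis
    by (unfold_locales)
      (auto simp: M_phi_def proj_eq coproj_def R scaleC_prod_def scaleC_complex_def U.add U.diff U.scale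
        cinner_add_left cinner_scaleC_left algebra_simps complex_vector.scale_right_diff_distrib
        complex_vector.scale_left_distrib complex_vector.scale_right_distrib
        add_divide_distrib)
qed

lemma M_phi_bounded_linear:
  assumes "unitary U"
  shows "bounded_linear (M_phi a U)"
proof -
  interpret M: Vector_Spaces.linear scaleC scaleC "M_phi a U"
    by (rule M_phi_clinear[OF assms])
  have P: "norm (proj a x) \<le> norm x" for x
  proof (cases "a = 0")
    case False
    have "norm (proj a x) = norm (cinner x a) / norm a"
      using False by (simp add: proj_eq norm_scaleC norm_divide cinner_self power2_eq_square norm_mult)
    also have "\<dots> \<le> norm x"
      using Cauchy_Schwarz[of x a] False by (simp add: field_simps)
    finally show ?thesis .
  qed (simp add: proj_eq)
  show ?thesis
  proof (rule bounded_linear_intro)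
    fix p :: "'a \<times> complex"
    obtain x l where p: "p = (x, l)" by (cases p)
    have nx: "norm x \<le> norm p" "norm l \<le> norm p"
      using p norm_fst_le[of x l] norm_snd_le[of l x] by auto
    have "norm (M_phi a U p) \<le>
        norm (U (proj a x + alpha a *\<^sub>R coproj a x) - l *\<^sub>C U a) + norm (- cinner x a + l)"
      unfolding p M_phi_def by (simp add: norm_Pair sqrt_sum_squares_le_sum)
    also have "\<dots> \<le> (norm (proj a x + alpha a *\<^sub>R coproj a x) + norm l * norm a) +
        (norm x * norm a + norm l)"
      by (intro add_mono order.trans[OF norm_triangle_ineq4] order.trans[OF norm_triangle_ineq])
        (auto simp: unitary_norm[OF assms] norm_scaleC Cauchy_Schwarz)
    also have "norm (proj a x + alpha a *\<^sub>R coproj a x) \<le> norm x + \<bar>alpha a\<bar> * (norm x + norm x)"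
      unfolding coproj_def
      by (intro order.trans[OF norm_triangle_ineq] add_mono P)
        (auto intro!: mult_left_mono order.trans[OF norm_triangle_ineq4] add_mono P)
    also have "norm x + \<bar>alpha a\<bar> * (norm x + norm x) + norm l * norm a + (norm x * norm a + norm l)
        \<le> norm p + \<bar>alpha a\<bar> * (norm p + norm p) + norm p * norm a + (norm p * norm a + norm p)"
      by (intro add_mono mult_mono) (auto simp: nx)
    finally show "norm (M_phi a U p) \<le> norm p * (2 + 2 * \<bar>alpha a\<bar> + 2 * norm a)"
      by (simp add: algebra_simps)
  next
    fix r and p :: "'a \<times> complex"
    show "M_phi a U (r *\<^sub>R p) = r *\<^sub>R M_phi a U p"
      using M.scale[of "complex_of_real r" p] by (simp add: scaleC_of_real)
  qed (rule M.add)
qed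

end

theory Submission
  imports Defs
begin

text \<open>The operator \<^term>\<open>M_phi a U\<close> stretches one direction more than all others. On the orthogonal
  complement of \<open>(a, 0)\<close> and \<open>(0, 1)\<close> it is \<^term>\<open>alpha a\<close> times an isometry, and on the plane
  spanned by \<open>u = - a / \<parallel>a\<parallel>\<close> and \<open>1\<close> it is, up to the unitary factor, the symmetric matrix with
  diagonal entries \<open>1\<close> and off-diagonal entries \<open>\<parallel>a\<parallel>\<close>. Its singular values are therefore
  \<open>1 + \<parallel>a\<parallel>\<close>, attained at \<open>v = (u, 1) / \<surd>2\<close>, and \<open>1 - \<parallel>a\<parallel>\<close> and \<open>\<surd>(1 - \<parallel>a\<parallel>\<^sup>2)\<close>, which are strictly
  smaller because \<open>a \<noteq> 0\<close>. The computation behind this is the Lorentz-type identity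
  \<open>norm_numerator_sq\<close>; it yields the gap in \<open>norm_M_phi_sq_gap\<close> and also shows that
  \<^term>\<open>phi a U\<close> preserves the unit sphere.

  When an operator \<open>S\<close> attains its norm along a single direction \<open>v\<close>, with a quadratic gap elsewhere,
  Birkhoff--James orthogonality to \<open>T\<close> amounts to orthogonality of the vectors \<open>S v\<close> and \<open>T v\<close>
  (\<open>bj_orthogonal_iff_of_gap\<close>). The gap forces near-maximizers of \<open>S\<close> to be close
  to a multiple of \<open>v\<close>, so a small perturbation that shortens \<open>S v\<close> lowers the whole norm.

  Finally \<^term>\<open>M_phi a U\<close> represents \<^term>\<open>phi a U\<close> in homogeneous coordinates: it sends \<open>(z, 1)\<close> to a
  nonzero multiple of \<open>(\<phi> z, 1)\<close> (\<open>M_phi_affine_point\<close>). So the condition at \<open>v\<close> reads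
  \<open>\<langle>\<phi> u, \<psi> u\<rangle> + 1 = 0\<close> for the two automorphisms \<open>\<phi>\<close> and \<open>\<psi>\<close>, and for unit vectors an inner product
  of \<open>- 1\<close> is the equality case of Cauchy--Schwarz that makes them antipodal.\<close>

section \<open>Geometry of complex inner product spaces\<close>

lemma norm_add_sq:
  "(norm (x + y))\<^sup>2 = (norm x)\<^sup>2 + (norm y)\<^sup>2 + 2 * Re (cinner x (y :: 'a :: complex_inner))"
proof -
  have "Re (cinner y x) = Re (cinner x y)"
    by (subst cinner_commute) simp
  moreover have "complex_of_real ((norm (x + y))\<^sup>2) =
      complex_of_real ((norm x)\<^sup>2 + (norm y)\<^sup>2) + (cinner x y + cinner y x)"
    by (simp only: cinner_self[symmetric] cinner_add_left cinner_add_right of_real_add) simp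
  then have "(norm (x + y))\<^sup>2 = (norm x)\<^sup>2 + (norm y)\<^sup>2 + (Re (cinner x y) + Re (cinner y x))"
    by (metis Re_complex_of_real plus_complex.simps(1))
  ultimately show ?thesis by simp
qed

lemma norm_Pair_sq: "(norm (x, y))\<^sup>2 = (norm x)\<^sup>2 + (norm y)\<^sup>2"
  by (simp add: norm_Pair)

lemma norm_residual_sq:
  fixes v :: "'a :: complex_inner"
  assumes "norm v = 1"
  shows "(norm (p - cinner p v *\<^sub>C v))\<^sup>2 = (norm p)\<^sup>2 - (cmod (cinner p v))\<^sup>2"
proof -
  let ?w = "p - cinner p v *\<^sub>C v"
  have "cinner ?w v = 0"
    using assms by (simp add: cinner_diff_left cinner_scaleC_left cinner_self)
  then have "(norm (?w + cinner p v *\<^sub>C v))\<^sup>2 = (norm ?w)\<^sup>2 + (norm (cinner p v *\<^sub>C v))\<^sup>2"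
    by (simp only: norm_add_sq cinner_scaleC_right) simp
  then show ?thesis using assms by (simp add: norm_scaleC)
qed

lemma antipodal_iff_cinner:
  fixes x y :: "'a :: complex_inner"
  assumes "norm x = 1" "norm y = 1"
  shows "x = - y \<longleftrightarrow> cinner x y = -1"
proof
  assume "x = - y"
  then have "x = (-1) *\<^sub>C y" by simp
  then show "cinner x y = -1" using assms by (simp only: cinner_scaleC_left cinner_self) simp
next
  assume "cinner x y = -1"
  then have "(norm (x + y))\<^sup>2 = 0" using assms by (simp add: norm_add_sq)
  then show "x = - y" by (simp add: eq_neg_iff_add_eq_0)
qed

section \<open>Birkhoff--James orthogonality of an operator with a norm gap\<close>

lemma bounded_linear_scaleC: "bounded_linear (\<lambda>x :: 'a :: complex_inner. c *\<^sub>C x)"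
proof (rule bounded_linear_intro)
  show "c *\<^sub>C r *\<^sub>R x = r *\<^sub>R c *\<^sub>C x" for r and x :: 'a
    by (simp add: scaleC_of_real[symmetric] scaleC_scaleC mult.commute)
  show "norm (c *\<^sub>C x) \<le> norm x * cmod c" for x :: 'a by (simp add: norm_scaleC)
qed (rule scaleC_add_right)

text \<open>By Pythagoras, \<open>S + c T\<close> already stretches the maximizer \<open>v\<close> by at least the norm of \<open>S\<close>.\<close>

lemma bj_orthogonal_of_maximizer:
  fixes S T :: "'a :: complex_inner \<Rightarrow> 'b :: complex_inner"
  assumes S: "bounded_linear S" and T: "bounded_linear T"
    and v: "norm v = 1" "norm (S v) = onorm S" and orth: "cinner (S v) (T v) = 0"
  shows "S \<bottom>\<^sub>B T"
  unfolding bj_orthogonal_def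
proof
  fix c
  have "(norm (S v))\<^sup>2 \<le> (norm (S v + c *\<^sub>C T v))\<^sup>2"
    by (simp add: norm_add_sq cinner_scaleC_right orth)
  then have "onorm S \<le> norm (S v + c *\<^sub>C T v)"
    using v by (metis norm_ge_zero power2_le_imp_le)
  also have "\<dots> \<le> onorm (\<lambda>x. S x + c *\<^sub>C T x)"
    using onorm[of "\<lambda>x. S x + c *\<^sub>C T x" v] v
      bounded_linear_add[OF S bounded_linear_compose[OF bounded_linear_scaleC T]] by simp
  finally show "onorm S \<le> onorm (\<lambda>x. S x + c *\<^sub>C T x)" .
qed

text \<open>Suppose \<open>z = \<langle>S v, T v\<rangle>\<close> is nonzero and perturb by \<open>c = - r z\<close> with a small \<open>r > 0\<close>. Write
  \<open>p = k v + w\<close> with \<open>w\<close> orthogonal to \<open>v\<close>. In the expansion of \<open>\<parallel>S p + c T p\<parallel>\<^sup>2\<close> the cross term contains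
  \<open>- 2 r \<bar>z\<bar>\<^sup>2 \<bar>k\<bar>\<^sup>2\<close>, a decrease of first order in \<open>r\<close>. The remaining part of the cross term is of size
  \<open>r \<parallel>w\<parallel> \<parallel>p\<parallel>\<close>, which the gap \<open>- g \<parallel>w\<parallel>\<^sup>2\<close> absorbs at the cost of a term of order \<open>r\<^sup>2\<close>. Hence the
  square of the norm drops uniformly in \<open>p\<close>.\<close>

lemma bj_orthogonal_imp_cinner_eq_0:
  fixes S T :: "'a :: complex_inner \<Rightarrow> 'b :: complex_inner"
  assumes S: "bounded_linear S" "clinear S" and T: "bounded_linear T" "clinear T"
    and v: "norm v = 1" and "g > 0"
    and gap: "\<And>p. (norm (S p))\<^sup>2 \<le>
      (onorm S)\<^sup>2 * (norm p)\<^sup>2 - g * ((norm p)\<^sup>2 - (cmod (cinner p v))\<^sup>2)"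
    and bj: "S \<bottom>\<^sub>B T"
  shows "cinner (S v) (T v) = 0"
proof (rule ccontr)
  assume nz: "cinner (S v) (T v) \<noteq> 0"
  interpret S: Vector_Spaces.linear scaleC scaleC S by (rule S(2))
  interpret T: Vector_Spaces.linear scaleC scaleC T by (rule T(2))
  define z D N t where "z = cinner (S v) (T v)" and "D = cmod z"
    and "N = onorm S" and "t = onorm T"
  \<comment> \<open>The bound for \<open>\<parallel>S p + c T p\<parallel>\<^sup>2 / \<parallel>p\<parallel>\<^sup>2\<close> will be \<open>N\<^sup>2 - 2 r D\<^sup>2 + r\<^sup>2 E\<close>, where \<open>L\<close> collects the coefficients
      of the terms of size \<open>r \<parallel>w\<parallel> \<parallel>p\<parallel>\<close>. The choice of \<open>r\<close> minimises it, with minimum \<open>Q\<close>.\<close>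
  define L where "L = D\<^sup>2 + 2 * D * (N * t)"
  define E where "E = L\<^sup>2 / g + D\<^sup>2 * t\<^sup>2"
  define r where "r = D\<^sup>2 / E"
  define c where "c = - complex_of_real r * z"
  define Q where "Q = N\<^sup>2 - r * D\<^sup>2"
  have D: "D > 0" using nz by (simp add: D_def z_def)
  have Nt: "N \<ge> 0" "t \<ge> 0" using S T by (simp_all add: N_def t_def onorm_pos_le)
  have "L > 0" using D Nt by (simp add: L_def add_pos_nonneg)
  then have E: "E > 0" using \<open>g > 0\<close> by (simp add: E_def add_pos_nonneg)
  have r: "r > 0" using D E by (simp add: r_def)
  have nS: "norm (S x) \<le> N * norm x" for x using onorm[OF S(1)] by (simp add: N_def)
  have nT: "norm (T x) \<le> t * norm x" for x using onorm[OF T(1)] by (simp add: t_def)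
  have cmod_c: "cmod c = r * D" using r by (simp add: c_def D_def norm_mult)
  have cz: "cnj c * z = - complex_of_real (r * D\<^sup>2)"
    by (simp add: c_def D_def complex_norm_square mult.commute mult.left_commute del: of_real_power)
  have key: "(norm (S p + c *\<^sub>C T p))\<^sup>2 \<le> Q * (norm p)\<^sup>2" for p
  proof -
    define k w n where "k = cinner p v" and "w = p - k *\<^sub>C v" and "n = norm p"
    define R where "R = cinner (S w) (T p) + cinner (S (k *\<^sub>C v)) (T w)"
    have w2: "(norm w)\<^sup>2 = n\<^sup>2 - (cmod k)\<^sup>2"
      using norm_residual_sq[OF v, of p] by (simp add: k_def w_def n_def)
    have n: "n \<ge> 0" by (simp add: n_def)
    have wn: "norm w \<le> n"
      using w2 by (intro power2_le_imp_le[OF _ n]) simp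
    have kn: "norm (k *\<^sub>C v) \<le> n"
      using w2 n v by (simp add: norm_scaleC) (metis diff_ge_0_iff_ge power2_le_imp_le zero_le_power2)
    have p: "p = k *\<^sub>C v + w" by (simp add: w_def)
    have "cinner (S p) (T p) = cinner (S (k *\<^sub>C v)) (T p) + cinner (S w) (T p)"
      by (subst p) (simp add: S.add cinner_add_left)
    also have "cinner (S (k *\<^sub>C v)) (T p) =
        cinner (S (k *\<^sub>C v)) (T (k *\<^sub>C v)) + cinner (S (k *\<^sub>C v)) (T w)"
      by (subst p) (simp add: T.add cinner_add_right)
    also have "cinner (S (k *\<^sub>C v)) (T (k *\<^sub>C v)) = complex_of_real ((cmod k)\<^sup>2) * z"
      by (simp add: S.scale T.scale cinner_scaleC_left cinner_scaleC_right z_def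
          complex_norm_square del: of_real_power)
    finally have "cinner (S p) (T p) = complex_of_real ((cmod k)\<^sup>2) * z + R"
      by (simp add: R_def)
    then have "cnj c * cinner (S p) (T p) = complex_of_real ((cmod k)\<^sup>2) * (cnj c * z) + cnj c * R"
      by (simp add: algebra_simps)
    then have eq: "Re (cnj c * cinner (S p) (T p)) = - (r * D\<^sup>2) * (cmod k)\<^sup>2 + Re (cnj c * R)"
      unfolding cz by (simp del: of_real_power of_real_mult complex_cnj_mult)
    have "cmod R \<le> norm (S w) * norm (T p) + norm (S (k *\<^sub>C v)) * norm (T w)"
      unfolding R_def by (intro order.trans[OF norm_triangle_ineq] add_mono Cauchy_Schwarz)
    also have "\<dots> \<le> (N * norm w) * (t * n) + (N * n) * (t * norm w)"
      using Nt n kn unfolding n_def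
      by (intro add_mono mult_mono nT order.trans[OF nS]) (auto intro: mult_left_mono)
    finally have R: "cmod R \<le> 2 * (N * t) * norm w * n" by (simp add: algebra_simps)
    have "Re (cnj c * R) \<le> cmod (cnj c * R)" by (rule complex_Re_le_cmod)
    also have "\<dots> = r * D * cmod R" by (simp add: norm_mult cmod_c)
    also have "\<dots> \<le> r * D * (2 * (N * t) * norm w * n)"
      using R r D by (intro mult_left_mono) auto
    finally have cR: "Re (cnj c * R) \<le> r * D * (2 * (N * t) * norm w * n)" .
    have "r * D\<^sup>2 * (norm w)\<^sup>2 \<le> r * D\<^sup>2 * (norm w * n)"
      using r wn by (intro mult_left_mono) (auto simp: power2_eq_square intro: mult_left_mono)
    have "Re (cnj c * cinner (S p) (T p)) \<le> - (r * D\<^sup>2 * n\<^sup>2) + r * L * norm w * n"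
    proof -
      have "(cmod k)\<^sup>2 = n\<^sup>2 - (norm w)\<^sup>2" using w2 by simp
      then have "- (r * D\<^sup>2) * (cmod k)\<^sup>2 = - (r * D\<^sup>2 * n\<^sup>2) + r * D\<^sup>2 * (norm w)\<^sup>2"
        by (simp add: right_diff_distrib)
      moreover have "r * L * norm w * n =
          r * D\<^sup>2 * (norm w * n) + r * D * (2 * (N * t) * norm w * n)"
        by (simp add: L_def algebra_simps power2_eq_square)
      ultimately show ?thesis unfolding eq using cR \<open>r * D\<^sup>2 * (norm w)\<^sup>2 \<le> _\<close> by linarith
    qed
    moreover have "(norm (c *\<^sub>C T p))\<^sup>2 \<le> (r * D * (t * n))\<^sup>2"
      unfolding norm_scaleC cmod_c n_def using r D
      by (intro power_mono mult_left_mono nT) auto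
    moreover have "(norm (S p))\<^sup>2 \<le> N\<^sup>2 * n\<^sup>2 - g * (norm w)\<^sup>2"
      using gap[of p] unfolding w2 N_def n_def k_def .
    \<comment> \<open>Here the gap absorbs the terms linear in \<open>\<parallel>w\<parallel>\<close>, by completing the square.\<close>
    moreover have "2 * (r * L * norm w * n) \<le> g * (norm w)\<^sup>2 + r\<^sup>2 * (L\<^sup>2 / g) * n\<^sup>2"
    proof -
      have "0 \<le> (g * norm w - r * L * n)\<^sup>2 / g" using \<open>g > 0\<close> by simp
      also have "\<dots> = g * (norm w)\<^sup>2 - 2 * (r * L * norm w * n) + r\<^sup>2 * (L\<^sup>2 / g) * n\<^sup>2"
        using \<open>g > 0\<close> by (simp add: field_simps power2_eq_square)
      finally show ?thesis by simp
    qed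
    ultimately have "(norm (S p + c *\<^sub>C T p))\<^sup>2 \<le>
        N\<^sup>2 * n\<^sup>2 - 2 * (r * D\<^sup>2 * n\<^sup>2) + r\<^sup>2 * (L\<^sup>2 / g) * n\<^sup>2 + (r * D * (t * n))\<^sup>2"
      unfolding norm_add_sq cinner_scaleC_right by linarith
    also have "\<dots> = (N\<^sup>2 - 2 * (r * D\<^sup>2) + r * (r * E)) * n\<^sup>2"
      unfolding E_def by (simp add: algebra_simps power2_eq_square)
    also have "r * E = D\<^sup>2" using E by (simp add: r_def)
    finally show ?thesis by (simp add: Q_def n_def algebra_simps)
  qed
  have "0 \<le> (norm (S v + c *\<^sub>C T v))\<^sup>2" by simp
  also have "\<dots> \<le> Q" using key[of v] v by simp
  finally have Q: "Q \<ge> 0" .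
  have "onorm (\<lambda>x. S x + c *\<^sub>C T x) \<le> sqrt Q"
  proof (rule onorm_bound)
    show "norm (S p + c *\<^sub>C T p) \<le> sqrt Q * norm p" for p
      using real_le_rsqrt[OF key[of p]] by (simp add: real_sqrt_mult)
  qed (use Q in simp)
  also have "\<dots> < N"
    using Nt r D by (intro real_less_lsqrt) (auto simp: Q_def)
  finally show False using bj unfolding bj_orthogonal_def N_def by (meson not_le)
qed

lemma bj_orthogonal_iff_of_gap:
  fixes S T :: "'a :: complex_inner \<Rightarrow> 'b :: complex_inner"
  assumes "bounded_linear S" "clinear S" "bounded_linear T" "clinear T"
    and "norm v = 1" "norm (S v) = onorm S" "g > 0"
    and "\<And>p. (norm (S p))\<^sup>2 \<le>
      (onorm S)\<^sup>2 * (norm p)\<^sup>2 - g * ((norm p)\<^sup>2 - (cmod (cinner p v))\<^sup>2)"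
  shows "S \<bottom>\<^sub>B T \<longleftrightarrow> cinner (S v) (T v) = 0"
proof
  show "S \<bottom>\<^sub>B T" if "cinner (S v) (T v) = 0"
    by (rule bj_orthogonal_of_maximizer[OF assms(1,3,5,6) that])
  show "cinner (S v) (T v) = 0" if "S \<bottom>\<^sub>B T"
    by (rule bj_orthogonal_imp_cinner_eq_0[OF assms(1-5,7,8) that])
qed

section \<open>Ball automorphisms and their operators\<close>

text \<open>The Lorentz boost \<open>(x, l) \<mapsto> (P x + \<alpha> Q x - l a, l - \<langle>x, a\<rangle>)\<close> multiplies the indefinite form
  \<open>\<parallel>x\<parallel>\<^sup>2 - \<bar>l\<bar>\<^sup>2\<close> by \<open>\<alpha>\<^sup>2 = 1 - \<parallel>a\<parallel>\<^sup>2\<close>. The case \<open>l = 1\<close> is invariance of the sphere, and general \<open>l\<close>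
  gives the norm of \<open>M_phi\<close>.\<close>

lemma norm_numerator_sq:
  fixes a :: "'a :: complex_inner"
  assumes "norm a < 1"
  shows "(norm (proj a x + alpha a *\<^sub>R coproj a x - l *\<^sub>C a))\<^sup>2 =
    (cmod (l - cinner x a))\<^sup>2 + (1 - (norm a)\<^sup>2) * ((norm x)\<^sup>2 - (cmod l)\<^sup>2)"
proof (cases "a = 0")
  case True
  then show ?thesis by (simp add: proj_eq coproj_def alpha_def)
next
  case False
  define t k where "t = norm a" and "k = cinner x a / cinner a a"
  define y where "y = x - k *\<^sub>C a"
  have t: "t > 0" using False by (simp add: t_def)
  have aa: "cinner a a = complex_of_real (t\<^sup>2)" by (simp add: cinner_self t_def)
  have k: "cinner x a = complex_of_real (t\<^sup>2) * k" using t by (simp add: k_def aa)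
  have "cinner y a = 0"
    by (simp add: y_def cinner_diff_left cinner_scaleC_left k aa)
  then have o: "cinner y (c *\<^sub>C a) = 0" for c by (simp add: cinner_scaleC_right)
  have "x = y + k *\<^sub>C a" by (simp add: y_def)
  then have x2: "(norm x)\<^sup>2 = (norm y)\<^sup>2 + (cmod k)\<^sup>2 * t\<^sup>2"
    using norm_add_sq[of y "k *\<^sub>C a"] o by (simp add: norm_scaleC t_def power_mult_distrib)
  have "t\<^sup>2 \<le> 1"
    using assms t by (simp add: t_def power_le_one)
  then have al: "(alpha a)\<^sup>2 = 1 - t\<^sup>2" by (simp add: alpha_def t_def)
  have "proj a x + alpha a *\<^sub>R coproj a x - l *\<^sub>C a =
      complex_of_real (alpha a) *\<^sub>C y + (k - l) *\<^sub>C a"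
    by (simp add: coproj_def proj_eq k_def y_def scaleC_of_real complex_vector.scale_left_diff_distrib)
  then have "(norm (proj a x + alpha a *\<^sub>R coproj a x - l *\<^sub>C a))\<^sup>2 =
      (alpha a)\<^sup>2 * (norm y)\<^sup>2 + (cmod (k - l))\<^sup>2 * t\<^sup>2"
    by (simp only: norm_add_sq cinner_scaleC_left o norm_scaleC) (simp add: power_mult_distrib t_def)
  also have "\<dots> = (cmod (l - complex_of_real (t\<^sup>2) * k))\<^sup>2 + (1 - t\<^sup>2) * ((norm x)\<^sup>2 - (cmod l)\<^sup>2)"
    unfolding al x2 cmod_power2 by (simp add: algebra_simps power2_eq_square)
  finally show ?thesis unfolding k t_def .
qed

lemma norm_phi_eq_1:
  fixes a :: "'a :: complex_inner"
  assumes "norm a < 1" "unitary U" "norm z = 1" "cinner z a \<noteq> 1"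
  shows "norm (phi a U z) = 1"
proof -
  have "(norm (proj a z + alpha a *\<^sub>R coproj a z - a))\<^sup>2 = (cmod (1 - cinner z a))\<^sup>2"
    using norm_numerator_sq[OF assms(1), of z 1] assms(3) by simp
  then have "norm (proj a z + alpha a *\<^sub>R coproj a z - a) = cmod (1 - cinner z a)"
    by (simp add: power2_eq_iff_nonneg)
  then show ?thesis
    using assms(4) by (simp add: phi_def unitary_norm[OF assms(2)] norm_scaleC norm_divide)
qed

text \<open>Thus \<open>M_phi\<close> plays the role of the matrix of a fractional linear map: the denominator of \<open>phi\<close>
  is the last homogeneous coordinate.\<close>

lemma M_phi_affine_point:
  fixes a :: "'a :: complex_inner"
  assumes "unitary U" "cinner z a \<noteq> 1"
  shows "M_phi a U (z, 1) = (1 - cinner z a) *\<^sub>C (phi a U z, 1)"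
proof -
  interpret U: Vector_Spaces.linear scaleC scaleC U
    using assms(1) by (simp add: unitary_def)
  show ?thesis
    using assms(2) by (simp add: M_phi_def phi_def scaleC_prod_def scaleC_complex_def
        U.scale U.diff scaleC_scaleC)
qed

lemma norm_M_phi_sq:
  fixes a :: "'a :: complex_inner"
  assumes "norm a < 1" "unitary U"
  shows "(norm (M_phi a U (x, l)))\<^sup>2 =
    2 * (cmod (l - cinner x a))\<^sup>2 + (1 - (norm a)\<^sup>2) * ((norm x)\<^sup>2 - (cmod l)\<^sup>2)"
proof -
  interpret U: Vector_Spaces.linear scaleC scaleC U
    using assms(2) by (simp add: unitary_def)
  have "M_phi a U (x, l) =
      (U (proj a x + alpha a *\<^sub>R coproj a x - l *\<^sub>C a), l - cinner x a)"
    by (simp add: M_phi_def U.diff U.scale)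
  then show ?thesis
    by (simp only: norm_Pair_sq unitary_norm[OF assms(2)] norm_numerator_sq[OF assms(1)])
qed

text \<open>The squared singular values other than the largest are \<open>(1 - t)\<^sup>2\<close> and \<open>1 - t\<^sup>2\<close> with \<open>t = \<parallel>a\<parallel>\<close>, so
  their distances from \<open>(1 + t)\<^sup>2\<close> are \<open>4 t\<close> and \<open>2 t + 2 t\<^sup>2\<close>. Both are at least the constant \<open>2 t\<close>,
  and the difference of the two sides splits into \<open>2 t\<^sup>2\<close> times the squared length of the part of \<open>x\<close>
  orthogonal to \<open>a\<close> and \<open>t \<bar>\<langle>x, u\<rangle> - l\<bar>\<^sup>2\<close>.\<close>

lemma norm_M_phi_sq_gap:
  fixes a :: "'a :: complex_inner"
  assumes "norm a < 1" "unitary U" "a = - norm a *\<^sub>R u" "norm u = 1"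
  shows "(norm (M_phi a U p))\<^sup>2 \<le> (1 + norm a)\<^sup>2 * (norm p)\<^sup>2 -
    2 * norm a * ((norm p)\<^sup>2 - (cmod (cinner p ((1 / sqrt 2) *\<^sub>R (u, 1))))\<^sup>2)"
proof -
  obtain x l where p: "p = (x, l)" by (cases p)
  define t y where "t = norm a" and "y = cinner x u"
  have "a = complex_of_real (- t) *\<^sub>C u" using assms(3) by (simp only: scaleC_of_real t_def)
  then have xa: "cinner x a = - complex_of_real t * y" by (simp only: cinner_scaleC_right y_def) simp
  have "cinner p ((1 / sqrt 2) *\<^sub>R (u, 1)) = complex_of_real (1 / sqrt 2) * (y + l)"
    by (simp only: scaleC_of_real[symmetric] cinner_scaleC_right)
      (simp add: p cinner_prod_def cinner_complex_def y_def)
  then have pv: "(cmod (cinner p ((1 / sqrt 2) *\<^sub>R (u, 1))))\<^sup>2 = (cmod (y + l))\<^sup>2 / 2"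
    by (simp add: norm_mult norm_divide power_divide)
  have p2: "(norm p)\<^sup>2 = (norm x)\<^sup>2 + (cmod l)\<^sup>2" by (simp add: p norm_Pair_sq)
  have "(cmod y)\<^sup>2 \<le> (norm x)\<^sup>2"
    unfolding y_def using Cauchy_Schwarz[of x u] assms(4) by (intro power_mono) auto
  then have "0 \<le> 2 * t\<^sup>2 * ((norm x)\<^sup>2 - (cmod y)\<^sup>2) + t * (cmod (y - l))\<^sup>2"
    by (simp add: t_def)
  also have "\<dots> = (1 + t)\<^sup>2 * ((norm x)\<^sup>2 + (cmod l)\<^sup>2) -
      2 * t * ((norm x)\<^sup>2 + (cmod l)\<^sup>2 - (cmod (y + l))\<^sup>2 / 2) -
      (2 * (cmod (l - (- complex_of_real t * y)))\<^sup>2 + (1 - t\<^sup>2) * ((norm x)\<^sup>2 - (cmod l)\<^sup>2))"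
    unfolding cmod_power2 by (simp add: field_simps power2_eq_square)
  finally show ?thesis
    unfolding pv p2 unfolding p norm_M_phi_sq[OF assms(1,2)] xa t_def by linarith
qed

theorem theorem1p2:
  fixes a b :: "'a :: complex_hilbert_space" and U V :: "'a \<Rightarrow> 'a"
  assumes "a \<in> ball 0 1" and "b \<in> ball 0 1" and "a \<noteq> 0"
    and "unitary U" and "unitary V"
  shows "M_phi a U \<bottom>\<^sub>B M_phi b V \<longleftrightarrow>
    phi a U (- (a /\<^sub>R norm a)) \<in> sphere 0 1 \<and>
    phi b V (- (a /\<^sub>R norm a)) \<in> sphere 0 1 \<and>
    phi a U (- (a /\<^sub>R norm a)) = - phi b V (- (a /\<^sub>R norm a))"
proof -
  define u where "u = - (a /\<^sub>R norm a)"
  define v :: "'a \<times> complex" where "v = (1 / sqrt 2) *\<^sub>R (u, 1)"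
  have a: "norm a < 1" "norm a > 0" and b: "norm b < 1" using assms by auto
  have u: "norm u = 1" "a = - norm a *\<^sub>R u" using a by (simp_all add: u_def)
  have v1: "norm v = 1" by (simp add: v_def norm_prod_def u(1) power_divide)
  have vC: "v = complex_of_real (1 / sqrt 2) *\<^sub>C (u, 1)" by (simp only: v_def scaleC_of_real)
  have not1: "cinner u c \<noteq> 1" if "norm c < 1" for c
    using Cauchy_Schwarz[of u c] u(1) that by auto
  have Mv: "M_phi c W v =
      (complex_of_real (1 / sqrt 2) * (1 - cinner u c)) *\<^sub>C (phi c W u, 1)"
    if "norm c < 1" "unitary W" for c W
  proof -
    interpret M: Vector_Spaces.linear scaleC scaleC "M_phi c W"
      by (rule M_phi_clinear[OF that(2)])
    show ?thesis
      unfolding vC M.scale M_phi_affine_point[OF that(2) not1[OF that(1)]] scaleC_scaleC ..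
  qed
  have phi1: "norm (phi a U u) = 1" "norm (phi b V u) = 1"
    using norm_phi_eq_1[OF _ _ u(1) not1] assms(4,5) a b by simp_all
  have gap: "(norm (M_phi a U p))\<^sup>2 \<le> (1 + norm a)\<^sup>2 * (norm p)\<^sup>2 -
      2 * norm a * ((norm p)\<^sup>2 - (cmod (cinner p v))\<^sup>2)" for p
    unfolding v_def by (rule norm_M_phi_sq_gap[OF a(1) assms(4) u(2,1)])
  have "cinner u a = complex_of_real (- norm a) * cinner u u"
    by (subst u(2), simp only: scaleC_of_real[symmetric] cinner_scaleC_right) simp
  then have "1 - cinner u a = complex_of_real (1 + norm a)" by (simp add: cinner_self u(1))
  then have nMv: "norm (M_phi a U v) = 1 + norm a"
    unfolding Mv[OF a(1) assms(4)] norm_scaleC norm_mult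
    by (simp add: norm_prod_def phi1 norm_divide del: of_real_add)
  have on: "onorm (M_phi a U) = 1 + norm a"
  proof (rule antisym)
    show "onorm (M_phi a U) \<le> 1 + norm a"
    proof (rule onorm_bound)
      fix p
      have "(cmod (cinner p v))\<^sup>2 \<le> (norm p)\<^sup>2"
        using Cauchy_Schwarz[of p v] v1 by (intro power_mono) auto
      then have "(norm (M_phi a U p))\<^sup>2 \<le> ((1 + norm a) * norm p)\<^sup>2"
        using gap[of p] by (smt (verit) mult_nonneg_nonneg norm_ge_zero power_mult_distrib)
      then show "norm (M_phi a U p) \<le> (1 + norm a) * norm p"
        by (rule power2_le_imp_le) simp
    qed simp
    show "1 + norm a \<le> onorm (M_phi a U)"
      using onorm[OF M_phi_bounded_linear[OF assms(4)], of a v] nMv v1 by simp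
  qed
  have "M_phi a U \<bottom>\<^sub>B M_phi b V \<longleftrightarrow> cinner (M_phi a U v) (M_phi b V v) = 0"
    using assms(4,5) v1 nMv a gap
    by (intro bj_orthogonal_iff_of_gap[where g = "2 * norm a"])
      (simp_all add: on M_phi_bounded_linear M_phi_clinear)
  also have "\<dots> \<longleftrightarrow> cinner (phi a U u, 1 :: complex) (phi b V u, 1) = 0"
    unfolding Mv[OF a(1) assms(4)] Mv[OF b assms(5)] cinner_scaleC_left cinner_scaleC_right
    using not1[OF a(1)] not1[OF b] by (simp del: of_real_divide)
  also have "\<dots> \<longleftrightarrow> phi a U u = - phi b V u"
    unfolding antipodal_iff_cinner[OF phi1]
    by (simp add: cinner_prod_def cinner_complex_def eq_neg_iff_add_eq_0)
  finally show ?thesis using phi1 by (simp add: u_def)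
qed

end
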